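(* Let $f(\beta)=E_{\beta}(L T^{\beta})$. For any $\epsilon>0$, if $T$ is sufficiently large and $L<1$, then $f(\beta)$ is monotonically increasing on the interval $[\epsilon,1]$.
   Context: For $\beta>0$, $E_\beta$ denotes the Mittag-Leffler function of order $\beta$, defined by $E_{\beta}(z)=\sum_{j=0}^{\infty}\frac{z^j}{\Gamma(j\beta+1)}$ whenever the series converges, where $\Gamma$ is the gamma function. Here $L$ is the Lipschitz constant of the function $\mathcal{F}$ on the right-hand side of the fractional-order initial value problem $D_t^\beta \mathbf{X}(t)=\mathcal{F}(\mathbf{W},\mathbf{X}(t))$, $\mathbf{X}(0)=\mathbf{X}_0$, $0<\beta\le 1$, where $\mathbf{W}$ is the adjacency (edge weight) matrix of a graph, $\mathbf{X}(t)$ is the matrix of node features at time $t$, and $D_t^\beta$ is the Caputo fractional derivative in time, given componentwise by $D_t^\beta g(t)=\frac{1}{\Gamma(1-\beta)}\int_0^t (t-\tau)^{-\beta} g'(\tau)\,d\tau$ for $0<\beta<1$ and by the ordinary first derivative for $\beta=1$. $T$ is the terminal time at which the solution $\mathbf{X}(T)$ is taken as output. *)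

theory Defs
  imports "HOL-Analysis.Analysis"
begin

text \<open>
  Only real arguments are needed. For \<open>\<beta> > 0\<close> the series converges for every \<open>z\<close>, so the
  totality of \<open>suminf\<close> plays no role there.
\<close>
definition mittag_leffler :: "real \<Rightarrow> real \<Rightarrow> real" where
  "mittag_leffler \<beta> z = (\<Sum>j. z ^ j / Gamma (real j * \<beta> + 1))"

end

theory Submission imports Defs begin

text \<open>
  The partial sums \<open>\<Sum>j<n. L ^ j * g (j * \<beta>)\<close>, where \<open>g x = T powr x / Gamma (x + 1)\<close>, already
  have a nonnegative derivative in \<open>\<beta>\<close> for every \<open>n\<close> once \<open>T\<close> is large, so no series has to be
  differentiated. The sign of \<open>g' x = g x * (ln T - Digamma (x + 1))\<close> changes near \<open>x = T\<close>. With
  \<open>q = sqrt L\<close>, the terms \<open>L ^ j * g (j * \<beta>)\<close> decay at least like \<open>q ^ j\<close> as soon as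
  \<open>j * \<beta> \<ge> q * T\<close>; hence the single derivative term with \<open>j * \<beta>\<close> just above \<open>q * T\<close> dominates
  all negative ones, which have \<open>j * \<beta> > T - 1\<close>.
\<close>

section \<open>Estimates for Digamma and Gamma from the mean value theorem\<close>

lemma Digamma_bounds:
  fixes x :: real
  assumes "x > 0"
  shows "Digamma x \<le> ln x" "ln x \<le> Digamma (x + 1)"
proof -
  have "\<exists>z. x < z \<and> z < x + 1 \<and> ln_Gamma (x + 1) - ln_Gamma x = (x + 1 - x) * Digamma z"
    by (rule MVT2) (use assms in \<open>auto intro!: derivative_eq_intros\<close>)
  then obtain z where z: "x < z" "z < x + 1" "ln_Gamma (x + 1) - ln_Gamma x = Digamma z"
    by auto
  have "Gamma (x + 1) = x * Gamma x"
    using assms by (intro Gamma_plus1) (auto elim!: nonpos_Ints_cases)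
  moreover have "Gamma x \<noteq> 0"
    using Gamma_real_pos[OF assms] by linarith
  \<comment> \<open>The functional equation makes the mean slope of \<open>ln_Gamma\<close> on
    [x, x + 1] equal to \<open>ln x\<close>; strict monotonicity of \<open>Digamma\<close> then
    encloses it between the endpoint values.\<close>
  ultimately have "Digamma z = ln x"
    using assms z by (simp add: ln_Gamma_real_pos ln_mult)
  with z assms Digamma_real_strict_mono[of x z] Digamma_real_strict_mono[of z "x + 1"]
  show "Digamma x \<le> ln x" "ln x \<le> Digamma (x + 1)" by auto
qed

text \<open>The slope of \<open>ln_Gamma\<close> beyond \<open>y + 1\<close> is at least
  \<open>ln y\<close>; integrate over a length \<open>d\<close> and exponentiate.\<close>

lemma Gamma_plus_ge_powr_mult:
  fixes y d :: real
  assumes "y > 0" "d > 0"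
  shows "y powr d * Gamma (y + 1) \<le> Gamma (y + d + 1)"
proof -
  have "\<exists>z. y + 1 < z \<and> z < y + d + 1 \<and>
      ln_Gamma (y + d + 1) - ln_Gamma (y + 1) = (y + d + 1 - (y + 1)) * Digamma z"
    by (rule MVT2) (use assms in \<open>auto intro!: derivative_eq_intros\<close>)
  then obtain z where z: "y + 1 < z" "ln_Gamma (y + d + 1) - ln_Gamma (y + 1) = d * Digamma z"
    by auto
  have "ln y \<le> Digamma z"
    using Digamma_bounds(2)[of y] Digamma_real_strict_mono[of "y + 1" z] assms z by auto
  with assms z(2) have "d * ln y \<le> ln (Gamma (y + d + 1)) - ln (Gamma (y + 1))"
    by (simp add: ln_Gamma_real_pos)
  also have "\<dots> = ln (Gamma (y + d + 1) / Gamma (y + 1))"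
    using Gamma_real_pos[of "y + 1"] Gamma_real_pos[of "y + d + 1"] assms
    by (simp add: ln_divide_pos)
  finally have "exp (d * ln y) \<le> Gamma (y + d + 1) / Gamma (y + 1)"
    using assms by (subst (asm) ln_ge_iff) (auto simp: Gamma_real_pos)
  thus ?thesis
    using assms by (simp add: powr_def field_simps Gamma_real_pos)
qed

section \<open>The weight of a term as a function of a continuous variable\<close>

definition powr_over_Gamma :: "real \<Rightarrow> real \<Rightarrow> real" where
  "powr_over_Gamma T x = T powr x / Gamma (x + 1)"

lemma powr_over_Gamma_pos: "T > 0 \<Longrightarrow> x \<ge> 0 \<Longrightarrow> powr_over_Gamma T x > 0"
  by (simp add: powr_over_Gamma_def Gamma_real_pos)

lemma has_real_derivative_powr_over_Gamma:
  assumes "T > 0" "x \<ge> 0"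
  shows "(powr_over_Gamma T has_real_derivative
           powr_over_Gamma T x * (ln T - Digamma (x + 1))) (at x within S)"
proof -
  have "Gamma (x + 1) \<noteq> 0"
    using assms Gamma_real_pos[of "x + 1"] by linarith
  moreover have "x + 1 \<notin> \<int>\<^sub>\<le>\<^sub>0"
    using assms by (auto elim!: nonpos_Ints_cases)
  ultimately show ?thesis
    unfolding powr_over_Gamma_def [abs_def] powr_def using assms
    by (auto intro!: derivative_eq_intros simp: field_simps)
qed

lemma powr_over_Gamma_add_le:
  assumes "T > 0" "y > 0" "d > 0"
  shows "powr_over_Gamma T (y + d) \<le> (T / y) powr d * powr_over_Gamma T y"
proof -
  have "T powr (y + d) / Gamma (y + d + 1) \<le> T powr (y + d) / (y powr d * Gamma (y + 1))"
    using assms Gamma_plus_ge_powr_mult[of y d]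
    by (intro divide_left_mono mult_pos_pos) (auto simp: Gamma_real_pos)
  also have "\<dots> = (T / y) powr d * (T powr y / Gamma (y + 1))"
    using assms by (simp add: powr_divide powr_add)
  finally show ?thesis by (simp add: powr_over_Gamma_def)
qed

section \<open>Geometric decay of the terms\<close>

lemma mittag_leffler_eq_suminf:
  assumes "T > 0"
  shows "mittag_leffler \<beta> (L * T powr \<beta>) = (\<Sum>j. L ^ j * powr_over_Gamma T (real j * \<beta>))"
  using assms unfolding mittag_leffler_def powr_over_Gamma_def
  by (simp add: power_mult_distrib powr_power mult.commute)

text \<open>Passing to the next index costs a factor \<open>q\<^sup>2\<close> from the power and
  gains at most \<open>1 / q\<close> from the weight: \<open>T / (j * \<beta>)\<close> is at most
  \<open>1 / q\<close>, and raising to the power \<beta> \<le> 1 keeps this bound because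
  \<open>1 / q > 1\<close>.\<close>

lemma term_ratio:
  assumes "0 < q" "q < 1" "T > 0" "0 < \<beta>" "\<beta> \<le> 1" "q * T \<le> real j * \<beta>"
  shows "(q\<^sup>2) ^ Suc j * powr_over_Gamma T (real (Suc j) * \<beta>)
         \<le> q * ((q\<^sup>2) ^ j * powr_over_Gamma T (real j * \<beta>))"
proof -
  have pos: "real j * \<beta> > 0" using assms by (smt (verit) mult_pos_pos)
  have "T / (real j * \<beta>) \<le> 1 / q"
    using assms pos by (simp add: field_simps)
  then have "(T / (real j * \<beta>)) powr \<beta> \<le> (1 / q) powr \<beta>"
    using assms pos by (intro powr_mono2) auto
  also have "\<dots> \<le> (1 / q) powr 1"
    using assms by (intro powr_mono) auto
  finally have r: "(T / (real j * \<beta>)) powr \<beta> \<le> 1 / q" using assms by simp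
  have "powr_over_Gamma T (real (Suc j) * \<beta>)
      \<le> (T / (real j * \<beta>)) powr \<beta> * powr_over_Gamma T (real j * \<beta>)"
    using powr_over_Gamma_add_le[of T "real j * \<beta>" \<beta>] assms pos by (simp add: algebra_simps)
  also have "\<dots> \<le> 1 / q * powr_over_Gamma T (real j * \<beta>)"
    using r powr_over_Gamma_pos[of T "real j * \<beta>"] assms pos by (intro mult_right_mono) auto
  finally have "(q\<^sup>2) ^ Suc j * powr_over_Gamma T (real (Suc j) * \<beta>)
      \<le> (q\<^sup>2) ^ Suc j * (1 / q * powr_over_Gamma T (real j * \<beta>))"
    by (intro mult_left_mono) auto
  also have "\<dots> = q * ((q\<^sup>2) ^ j * powr_over_Gamma T (real j * \<beta>))"
    using assms by (simp add: power2_eq_square)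
  finally show ?thesis .
qed

lemma summable_terms:
  assumes "0 < q" "q < 1" "T > 0" "0 < \<beta>" "\<beta> \<le> 1"
  shows "summable (\<lambda>j. (q\<^sup>2) ^ j * powr_over_Gamma T (real j * \<beta>))"
proof (rule summable_ratio_test)
  fix j assume "nat \<lceil>q * T / \<beta>\<rceil> \<le> j"
  then have "q * T / \<beta> \<le> real j" by linarith
  then have "q * T \<le> real j * \<beta>" using assms by (simp add: field_simps)
  from term_ratio[OF assms this]
  show "norm ((q\<^sup>2) ^ Suc j * powr_over_Gamma T (real (Suc j) * \<beta>))
      \<le> q * norm ((q\<^sup>2) ^ j * powr_over_Gamma T (real j * \<beta>))"
    using assms powr_over_Gamma_pos[of T "real j * \<beta>"] powr_over_Gamma_pos[of T "real (Suc j) * \<beta>"]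
    by (simp add: abs_mult del: power_Suc of_nat_Suc)
qed (use assms in auto)

lemma terms_le_geometric:
  assumes "0 < q" "q < 1" "T > 0" "0 < \<beta>" "\<beta> \<le> 1" "q * T \<le> real J * \<beta>"
  shows "(q\<^sup>2) ^ (J + k) * powr_over_Gamma T (real (J + k) * \<beta>)
         \<le> q ^ k * ((q\<^sup>2) ^ J * powr_over_Gamma T (real J * \<beta>))"
proof (induction k)
  case (Suc k)
  have "real J * \<beta> \<le> real (J + k) * \<beta>" using assms by (intro mult_right_mono) auto
  then have "q * T \<le> real (J + k) * \<beta>" using assms(6) by linarith
  from term_ratio[OF assms(1-5) this] mult_left_mono[OF Suc, of q] assms(1)
  show ?case
    by (simp only: add_Suc_right power_Suc[of q] mult.assoc) linarith
qed simp

section \<open>Sign of the derivative of the partial sums\<close>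

lemma summable_quadratic_mult_power:
  fixes q :: real
  assumes "0 \<le> q" "q < 1"
  shows "summable (\<lambda>k. (real k + 1) * (real k + 2) * q ^ k)"
proof -
  have 1: "summable (\<lambda>n. diffs (\<lambda>_. 1) n * x ^ n)" if "norm x < 1" for x :: real
    by (rule termdiff_converges[OF that]) (auto intro: summable_geometric)
  \<comment> \<open>The quadratic coefficients come from differentiating the geometric series
    twice.\<close>
  have "summable (\<lambda>n. diffs (diffs (\<lambda>_. 1)) n * q ^ n)"
    by (rule termdiff_converges[where K = 1]) (use assms 1 in auto)
  then show ?thesis by (simp add: diffs_def algebra_simps)
qed

text \<open>The number \<open>r\<close> fixes a margin \<open>- ln r\<close> for the dominant
  logarithmic factor. The tail beyond \<open>K\<close> is measured with a constant depending only on
  \<epsilon> and \<open>q\<close>, so \<open>K\<close> can be fixed before \<open>T\<close>,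
  uniformly in \<beta> and \<open>n\<close>.\<close>

lemma sum_derivative_nonneg:
  fixes q \<epsilon> r :: real
  assumes q: "0 < q" "q < r" "r < 1"
      and T: "T \<ge> 1" "q * T + 2 \<le> r * T" "4 \<le> (1 - q) * T" "2 * real K \<le> (1 - q) * T"
      and \<beta>: "0 < \<epsilon>" "\<epsilon> \<le> \<beta>" "\<beta> \<le> 1"
      and K: "\<And>n. (\<Sum>k\<in>{K..<n}. (1 + 2 / (\<epsilon> * (1 - q))) * ((real k + 1) * (real k + 2) * q ^ k)) \<le> - ln r"
  shows "0 \<le> (\<Sum>j<n. (q\<^sup>2) ^ j * (powr_over_Gamma T (real j * \<beta>) *
                (ln T - Digamma (real j * \<beta> + 1)) * real j))"
proof -
  define C where "C = 1 + 2 / (\<epsilon> * (1 - q))"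
  define c where "c k = C * ((real k + 1) * (real k + 2) * q ^ k)" for k
  define a where "a j = (q\<^sup>2) ^ j * powr_over_Gamma T (real j * \<beta>)" for j
  define D where "D j = ln T - Digamma (real j * \<beta> + 1)" for j
  define J where "J = nat \<lceil>q * T / \<beta>\<rceil>"
  have \<beta>0: "\<beta> > 0" using \<beta> by linarith
  have C: "C \<ge> 1" using q \<beta> by (simp add: C_def)
  have c0: "c k \<ge> 0" for k using C q by (simp add: c_def)
  have a0: "a j > 0" for j using q T \<beta>0 by (simp add: a_def powr_over_Gamma_pos)
  have "q * T / \<beta> > 0" using q T \<beta>0 by simp
  then have J0: "q * T / \<beta> \<le> real J" "real J < q * T / \<beta> + 1" "J \<ge> 1"
    unfolding J_def by linarith+
  have J1: "q * T \<le> real J * \<beta>" "real J * \<beta> \<le> q * T + 1"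
    using J0(1,2) \<beta>0 \<beta>(3) by (simp_all add: field_simps)
  \<comment> \<open>Rounding up to \<open>J\<close> overshoots \<open>q * T\<close> by at most
    \<beta> \<le> 1, and Digamma is taken at \<open>J * \<beta> + 1\<close>; this accounts for the 2
    in \<open>q * T + 2 \<le> r * T\<close>.\<close>
  have DJ: "D J \<ge> - ln r"
  proof -
    have "Digamma (real J * \<beta> + 1) \<le> ln (real J * \<beta> + 1)"
      using \<beta>0 by (intro Digamma_bounds) (simp add: add_nonneg_pos)
    also have "\<dots> \<le> ln (r * T)"
      using J1 T \<beta>0 by (intro ln_mono) (auto simp: add_nonneg_pos)
    also have "\<dots> = ln r + ln T" using q T by (simp add: ln_mult)
    finally show ?thesis by (simp add: D_def)
  qed
  have D_nonneg: "D j \<ge> 0" if "real j * \<beta> \<le> T - 1" for j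
  proof -
    have "Digamma (real j * \<beta> + 1) \<le> ln (real j * \<beta> + 1)"
      using \<beta>0 by (intro Digamma_bounds) (simp add: add_nonneg_pos)
    also have "\<dots> \<le> ln T"
      using that T \<beta>0 by (intro ln_mono) (auto simp: add_nonneg_pos)
    finally show ?thesis by (simp add: D_def)
  qed
  have D_ge: "D j \<ge> - real j" for j
  proof -
    have "Digamma (real j * \<beta> + 1) \<le> ln (real j * \<beta> + 1)"
      using \<beta>0 by (intro Digamma_bounds) (simp add: add_nonneg_pos)
    also have "\<dots> \<le> real j * \<beta>" using \<beta>0 ln_add_one_self_le_self[of "real j * \<beta>"] by (simp only: add.commute[of 1]) simp
    also have "\<dots> \<le> real j" using \<beta> by (simp add: mult_left_le)
    finally show ?thesis using T by (simp add: D_def) (smt (verit) ln_ge_zero)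
  qed
  have tail: "j \<ge> J + K \<and> a j * D j * real j \<ge> - (real J * a J * c (j - J))"
    if far: "real j * \<beta> > T - 1" for j
  proof -
    have "real j * \<beta> > real J * \<beta>" using far J1 T by (simp add: algebra_simps)
    then have jJ: "j > J" using \<beta>0 by simp
    define k where "k = j - J"
    have j: "j = J + k" using jJ by (simp add: k_def)
    have "(1 - q) * T - 2 \<le> real k * \<beta>" using far J1 by (simp add: j algebra_simps)
    also have "\<dots> \<le> real k" using \<beta> by (simp add: mult_left_le)
    \<comment> \<open>The lower bound 4 on \<open>(1 - q) * T\<close> absorbs the 2: the gap
      \<open>k\<close> is at least \<open>(1 - q) * T / 2\<close>, hence at least \<open>K\<close>
      and comparable with \<open>J\<close>.\<close>
    finally have k: "(1 - q) * T \<le> 2 * real k" using T by linarith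
    with T have kK: "k \<ge> K" by linarith
    have "real J * \<epsilon> \<le> real J * \<beta>" using \<beta> by (intro mult_left_mono) auto
    also have "\<dots> \<le> T" using J1 T q by (smt (verit) mult_left_le_one_le)
    finally have "real J * \<epsilon> * (1 - q) \<le> 2 * real k"
      using k q by (smt (verit) mult.commute mult_left_mono)
    then have "real J \<le> 2 / (\<epsilon> * (1 - q)) * real k"
      using \<beta> q by (simp add: field_simps)
    then have jC: "real j \<le> C * real k" by (simp add: j C_def algebra_simps)
    \<comment> \<open>One factor \<open>j\<close> is the inner derivative, the other bounds the
      logarithmic factor. Only one of them may cost a factor \<open>J\<close>, to match the weight
      \<open>J * a J\<close> of the dominant term; the other is bounded by
      \<open>C * k\<close>.\<close>
    have "real j \<le> real J * (real k + 1)"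
      using mult_right_mono[of 1 "real J" "real k"] J0(3) by (simp add: j algebra_simps)
    then have "real j * real j \<le> real J * (real k + 1) * (C * real k)"
      using jC C by (intro mult_mono) auto
    also have "\<dots> \<le> real J * (real k + 1) * (C * (real k + 2))"
      using C by (intro mult_left_mono) auto
    finally have jj: "real j * real j \<le> real J * (real k + 1) * (C * (real k + 2))" .
    have "a j \<le> q ^ k * a J"
      unfolding a_def j using q T J1 \<beta>0 \<beta> by (intro terms_le_geometric) auto
    then have "real j * real j * a j \<le> real J * (real k + 1) * (C * (real k + 2)) * (q ^ k * a J)"
      using a0[of j] C by (intro mult_mono[OF jj]) auto
    also have "\<dots> = real J * a J * c k" by (simp add: c_def)
    finally have 1: "real j * real j * a j \<le> real J * a J * c k" .
    have "a j * D j * real j \<ge> a j * (- real j) * real j"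
      using D_ge[of j] a0[of j] by (intro mult_right_mono mult_left_mono) auto
    with 1 have "a j * D j * real j \<ge> - (real J * a J * c k)" by (simp add: mult_ac)
    with kK show ?thesis by (simp add: j)
  qed
  \<comment> \<open>For \<open>K = 0\<close> both corrections apply at \<open>j = J\<close>, which
    only weakens the bound.\<close>
  have lower: "a j * D j * real j \<ge> (if j = J then real J * a J * (- ln r) else 0)
      - (if j \<ge> J + K then real J * a J * c (j - J) else 0)" for j
  proof -
    have nn: "real J * a J * c (j - J) \<ge> 0" using a0[of J] c0 by simp
    consider "j = J" | "j \<noteq> J" "real j * \<beta> \<le> T - 1" | "j \<noteq> J" "real j * \<beta> > T - 1" by linarith
    then show ?thesis
    proof cases
      case 1
      have "real J * a J * (- ln r) \<le> real J * a J * D J"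
        using DJ a0[of J] by (intro mult_left_mono) auto
      then show ?thesis using 1 nn by (auto simp: mult_ac)
    next
      case 2
      have "a j * D j * real j \<ge> 0" using D_nonneg[OF 2(2)] a0[of j] by simp
      then show ?thesis using 2 nn by auto
    next
      case 3
      then show ?thesis using tail[OF 3(2)] by auto
    qed
  qed
  have "0 \<le> (\<Sum>j<n. a j * D j * real j)"
  proof (cases "n \<le> J")
    \<comment> \<open>The dominant term is absent, but then every index has
      \<open>j * \<beta> \<le> q * T \<le> T - 1\<close>, so no term is negative.\<close>
    case True
    have "D j \<ge> 0" if "j < n" for j
    proof -
      have "real j \<le> q * T / \<beta>" using that True J0 by linarith
      then have "real j * \<beta> \<le> q * T" using \<beta>0 by (simp add: field_simps)
      then show ?thesis using T by (intro D_nonneg) (simp add: algebra_simps)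
    qed
    then show ?thesis using a0 by (intro sum_nonneg mult_nonneg_nonneg) (auto simp: less_imp_le)
  next
    case False
    have "(\<Sum>j<n. if j \<ge> J + K then real J * a J * c (j - J) else 0)
        = (\<Sum>j\<in>{J + K..<n}. real J * a J * c (j - J))"
      by (rule sum.mono_neutral_cong_right) auto
    also have "\<dots> = real J * a J * (\<Sum>k\<in>{K..<n - J}. c k)"
      unfolding sum_distrib_left
      by (rule sum.reindex_bij_witness[of _ "\<lambda>k. k + J" "\<lambda>j. j - J"]) auto
    also have "\<dots> \<le> real J * a J * (- ln r)"
      using K[of "n - J"] a0[of J] by (intro mult_left_mono) (auto simp: c_def C_def)
    also have "\<dots> = (\<Sum>j<n. if j = J then real J * a J * (- ln r) else 0)"
      using False by simp
    finally have "0 \<le> (\<Sum>j<n. (if j = J then real J * a J * (- ln r) else 0)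
      - (if j \<ge> J + K then real J * a J * c (j - J) else 0))"
      unfolding sum_subtractf by linarith
    also have "\<dots> \<le> (\<Sum>j<n. a j * D j * real j)"
      by (intro sum_mono lower)
    finally show ?thesis .
  qed
  then show ?thesis by (simp add: a_def D_def mult_ac)
qed

section \<open>Choice of parameters and passage to the limit\<close>

theorem theorem3:
  fixes \<epsilon> L :: real
  assumes "\<epsilon> > 0" and "0 \<le> L" and "L < 1"
  shows "\<forall>\<^sub>F T in at_top. mono_on {\<epsilon>..1} (\<lambda>\<beta>. mittag_leffler \<beta> (L * T powr \<beta>))"
proof (cases "L = 0")
  case True
  \<comment> \<open>The decay estimates need \<open>q > 0\<close>, so \<open>L = 0\<close> is
    separate: only the term with \<open>j = 0\<close> survives and the function is constant.\<close>
  have "(0::real) ^ j / Gamma (real j * \<beta> + 1) = (if j = 0 then 1 else 0)" for j \<beta>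
    by (cases j) auto
  then have "mittag_leffler \<beta> 0 = mittag_leffler \<beta>' 0" for \<beta> \<beta>'
    by (simp only: mittag_leffler_def)
  then have "mono_on {\<epsilon>..1} (\<lambda>\<beta>. mittag_leffler \<beta> (L * T powr \<beta>))" for T
    unfolding True mult_zero_left by (intro mono_onI eq_refl)
  then show ?thesis by simp
next
  case False
  define q where "q = sqrt L"
  \<comment> \<open>Any value strictly between \<open>q\<close> and 1 would serve.\<close>
  define r where "r = (1 + q) / 2"
  have q: "0 < q" "q < 1" "L = q\<^sup>2" using assms False by (auto simp: q_def)
  then have r: "q < r" "r < 1" by (auto simp: r_def)
  have "- ln r > 0" using q r by simp
  moreover have "summable (\<lambda>k::nat. (1 + 2 / (\<epsilon> * (1 - q))) * ((real k + 1) * (real k + 2) * q ^ k))"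
    using q by (intro summable_mult summable_quadratic_mult_power) auto
  \<comment> \<open>The Cauchy criterion bounds all finite blocks beyond \<open>K\<close> at once,
    which gives the tail bound for every \<open>n\<close>.\<close>
  ultimately obtain K where
    K': "\<forall>m\<ge>K. \<forall>n. norm (\<Sum>k\<in>{m..<n}. (1 + 2 / (\<epsilon> * (1 - q))) * ((real k + 1) * (real k + 2) * q ^ k)) < - ln r"
    unfolding summable_Cauchy by blast
  have K: "(\<Sum>k\<in>{K..<n}. (1 + 2 / (\<epsilon> * (1 - q))) * ((real k + 1) * (real k + 2) * q ^ k)) \<le> - ln r" for n
    using K'[rule_format, of K n] by (simp only: real_norm_def) linarith
  have "\<forall>\<^sub>F T in at_top. T \<ge> max 1 (max (2 / (r - q)) (max 4 (2 * real K) / (1 - q)))"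
    by (rule eventually_ge_at_top)
  then show ?thesis
  proof eventually_elim
    case (elim T)
    have T: "T \<ge> 1" "q * T + 2 \<le> r * T" "4 \<le> (1 - q) * T" "2 * real K \<le> (1 - q) * T"
      using elim q r by (auto simp: field_simps)
    define f where "f n \<beta> = (\<Sum>j<n. (q\<^sup>2) ^ j * powr_over_Gamma T (real j * \<beta>))" for n \<beta>
    show ?case
    proof (rule mono_onI)
      fix x y assume xy: "x \<in> {\<epsilon>..1}" "y \<in> {\<epsilon>..1}" "x \<le> y"
      have lim: "(\<lambda>n. f n \<beta>) \<longlonglongrightarrow> mittag_leffler \<beta> (L * T powr \<beta>)" if "\<beta> \<in> {\<epsilon>..1}" for \<beta>
        unfolding f_def using that q T assms(1) mittag_leffler_eq_suminf[of T \<beta> L]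
        by (auto intro!: summable_LIMSEQ summable_terms)
      have "f n x \<le> f n y" for n
      proof (rule DERIV_nonneg_imp_nondecreasing[OF xy(3)])
        fix \<beta> assume \<beta>: "x \<le> \<beta>" "\<beta> \<le> y"
        then have \<beta>': "\<epsilon> \<le> \<beta>" "\<beta> \<le> 1" using xy by auto
        have d: "((\<lambda>\<beta>. powr_over_Gamma T (real j * \<beta>)) has_real_derivative
            powr_over_Gamma T (real j * \<beta>) * (ln T - Digamma (real j * \<beta> + 1)) * real j) (at \<beta>)" for j
          using T assms(1) \<beta>'
          by (intro DERIV_chain2[OF has_real_derivative_powr_over_Gamma])
             (auto intro!: derivative_eq_intros)
        have "(f n has_real_derivative (\<Sum>j<n. (q\<^sup>2) ^ j * (powr_over_Gamma T (real j * \<beta>) *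
            (ln T - Digamma (real j * \<beta> + 1)) * real j))) (at \<beta>)"
          unfolding f_def [abs_def] by (intro DERIV_sum DERIV_cmult d)
        with sum_derivative_nonneg[OF q(1) r T assms(1) \<beta>' K, of n]
        show "\<exists>D. (f n has_real_derivative D) (at \<beta>) \<and> 0 \<le> D"
          by blast
      qed
      \<comment> \<open>Monotonicity holds for each partial sum with the same \<open>T\<close>, so
        it survives the pointwise limit.\<close>
      then show "mittag_leffler x (L * T powr x) \<le> mittag_leffler y (L * T powr y)"
        using lim xy by (intro LIMSEQ_le[of "\<lambda>n. f n x" _ "\<lambda>n. f n y"]) auto
    qed
  qed
qed

end
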